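(* There are a perfect non-squiggly set $P \subseteq \mathbb{R}^2$ and a $C^1$ arc $A \subseteq \mathbb{R}^2$ such that $P \subseteq A$ and such that $P \cap B$ is finite for every $C^2$ arc $B \subseteq \mathbb{R}^2$. Moreover, the $C^1$ arc $A$ may be taken to be the graph of a convex function.
   Context: An arc in $\mathbb{R}^2$ is a set homeomorphic to a closed bounded interval $[a,b] \subset \mathbb{R}$ ($a<b$). A path is a homeomorphism $g$ mapping a compact interval onto an arc. For $k \ge 1$, an arc $A$ is $C^k$ iff $A$ is the image of some path $g$ which is a $C^k$ function and satisfies $g'(t) \ne 0$ for all $t$ in its domain. A perfect set is a nonempty closed set without isolated points. A set $A \subseteq \mathbb{R}^2$ is non-squiggly iff there is a $\delta$ with $0 < \delta \le \infty$ such that whenever $x,y,z,t$ are four distinct points of $A$ with $\mathrm{diam}(\{x,y,z,t\}) \le \delta$, the point $t$ is not interior to the triangle $xyz$. A real differentiable function (here, on a compact interval) is convex iff its derivative is a monotonically increasing function. *)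

theory Defs
  imports "HOL-Analysis.Analysis"
begin

definition arc_set :: "'a::topological_space set \<Rightarrow> bool" where
  "arc_set A \<longleftrightarrow> (\<exists>a b::real. a < b \<and> A homeomorphic {a..b})"

text \<open>Unlike the library's path and arc, whose domain is always the unit interval, the
  parametrisation here may have any nondegenerate compact interval as its domain.\<close>

definition path_onto :: "real \<Rightarrow> real \<Rightarrow> (real \<Rightarrow> 'a::topological_space) \<Rightarrow> 'a set \<Rightarrow> bool" where
  "path_onto a b g A \<longleftrightarrow> a < b \<and> arc_set A \<and> (\<exists>h. homeomorphism {a..b} A g h)"

text \<open>\<open>D i\<close> is the \<open>i\<close>-th derivative of \<open>g\<close>. Derivatives are taken within \<open>S\<close>, so they are
  one-sided at the endpoints when \<open>S\<close> is a compact interval.\<close>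

definition Ck_on :: "nat \<Rightarrow> (real \<Rightarrow> 'a::real_normed_vector) \<Rightarrow> real set \<Rightarrow> bool" where
  "Ck_on k g S \<longleftrightarrow>
     (\<exists>D. D 0 = g \<and>
        (\<forall>i<k. \<forall>t\<in>S. (D i has_vector_derivative D (Suc i) t) (at t within S)) \<and>
        (\<forall>i\<le>k. continuous_on S (D i)))"

text \<open>Only meaningful for \<open>k \<ge> 1\<close>: for \<open>k = 0\<close> the vector derivative need not exist.\<close>

definition Ck_arc :: "nat \<Rightarrow> 'a::real_normed_vector set \<Rightarrow> bool" where
  "Ck_arc k A \<longleftrightarrow>
     (\<exists>a b g. path_onto a b g A \<and> Ck_on k g {a..b} \<and>
        (\<forall>t\<in>{a..b}. vector_derivative g (at t within {a..b}) \<noteq> 0))"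

definition perfect_set :: "'a::topological_space set \<Rightarrow> bool" where
  "perfect_set P \<longleftrightarrow> P \<noteq> {} \<and> closed P \<and> (\<forall>x\<in>P. \<not> x isolated_in P)"

text \<open>The bound \<open>\<delta>\<close> is an extended real because \<open>\<delta> = \<infinity>\<close> (no restriction on the diameter) is
  allowed. A degenerate triangle has empty interior.\<close>

definition non_squiggly :: "(real ^ 2) set \<Rightarrow> bool" where
  "non_squiggly A \<longleftrightarrow>
     (\<exists>\<delta>::ereal. 0 < \<delta> \<and> \<delta> \<le> \<infinity> \<and>
        (\<forall>x\<in>A. \<forall>y\<in>A. \<forall>z\<in>A. \<forall>t\<in>A.
           distinct [x, y, z, t] \<and> ereal (diameter {x, y, z, t}) \<le> \<delta> \<longrightarrow>
           t \<notin> interior (convex hull {x, y, z})))"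

text \<open>Convexity of a differentiable function in the sense of a monotone derivative, which is
  one-sided at the endpoints; monotone is meant in the weak sense.\<close>

definition convex_differentiable_on :: "real \<Rightarrow> real \<Rightarrow> (real \<Rightarrow> real) \<Rightarrow> bool" where
  "convex_differentiable_on a b f \<longleftrightarrow>
     (\<exists>f'. (\<forall>x\<in>{a..b}. (f has_real_derivative f' x) (at x within {a..b})) \<and>
        mono_on {a..b} f')"

definition graph_on :: "real set \<Rightarrow> (real \<Rightarrow> real) \<Rightarrow> (real ^ 2) set" where
  "graph_on S f = (\<lambda>x. vector [x, f x]) ` S"

end

theory Submission
  imports Defs
begin

text \<open>
  The idea is to build a convex \<open>C\<^sup>1\<close> function \<open>f\<close> whose second derivative is \<open>+\<infinity>\<close> at every
  point of a perfect set \<open>K\<close>, and to take for \<open>P\<close> the part of its graph over \<open>K\<close>. A \<open>C\<^sup>2\<close> arc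
  has bounded curvature, so it cannot pass through a sequence of points of \<open>P\<close> accumulating at
  a point of \<open>P\<close>; by compactness it meets \<open>P\<close> in a finite set (\<open>finite_inter_C2_arc\<close>).

  To obtain \<open>f\<close>, the derivative \<open>g = f'\<close> is constructed through its inverse \<open>\<phi>\<close>. Let \<open>C\<close> be a
  perfect nowhere dense subset of \<open>[0,1]\<close>, and let \<open>\<phi>\<close> be an antiderivative of the distance to
  \<open>C\<close>. Then \<open>\<phi>\<close> is strictly increasing, because its derivative vanishes on no interval, and
  \<open>\<phi>' = 0\<close> on \<open>C\<close> (\<open>cantor_flat_function\<close>). Hence \<open>g = \<phi>\<^sup>-\<^sup>1\<close> is continuous and increasing and has
  slope \<open>+\<infinity>\<close> at each point of \<open>K = \<phi> ` C\<close>. Every antiderivative \<open>f\<close> of \<open>g\<close> is convex and, at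
  each point of \<open>K\<close>, lies locally above its tangent line plus any prescribed multiple of the
  squared distance (\<open>steep_derivative_imp_parabola_bound\<close>).

  The set \<open>P\<close> is a homeomorphic copy of \<open>C\<close>, hence perfect. It is non-squiggly with \<open>\<delta> = \<infinity>\<close>
  because the graph of a convex function has a supporting line at each of its points, and such a
  point is never interior to a triangle with vertices on the graph.
\<close>

section \<open>Quadratic comparison with the tangent line\<close>

text \<open>The function \<open>f s - f x0 - g x0 * (s - x0) - M * (s - x0)\<^sup>2\<close> vanishes at \<open>x0\<close>, and by the last
  hypothesis it decreases to the left of \<open>x0\<close> and increases to the right of it. The case \<open>M = 0\<close>
  gives supporting lines of convex functions, large \<open>M\<close> expresses infinite curvature, and
  negative \<open>M\<close>, applied to \<open>-f\<close>, gives the Taylor estimate for \<open>C\<^sup>2\<close> curves.\<close>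

lemma quadratic_lower_bound:
  fixes f g :: "real \<Rightarrow> real"
  assumes "convex S" "x0 \<in> S" "x \<in> S"
    and der: "\<And>s. s \<in> S \<Longrightarrow> (f has_real_derivative g s) (at s within S)"
    and mono: "\<And>s. s \<in> S \<Longrightarrow> (g s - g x0) * (s - x0) \<ge> 2 * M * (s - x0)^2"
  shows "f x \<ge> f x0 + g x0 * (x - x0) + M * (x - x0)^2"
proof -
  define h where "h s = f s - f x0 - g x0 * (s - x0) - M * (s - x0)^2" for s
  define k where "k s = g s - g x0 - 2 * M * (s - x0)" for s
  have hder: "(h has_derivative (*) (k s)) (at s within T)" if "s \<in> T" "T \<subseteq> S" for s T
  proof -
    have "(f has_real_derivative g s) (at s within T)"
      using der that by (meson DERIV_subset subsetD)
    then have "(h has_real_derivative k s) (at s within T)"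
      unfolding h_def k_def by (auto intro!: derivative_eq_intros)
    then show ?thesis by (simp add: has_field_derivative_def)
  qed
  have sgn: "k s * (s - x0) \<ge> 0" if "s \<in> S" for s
    using mono[OF that] by (simp add: k_def algebra_simps power2_eq_square)
  have h0: "h x0 = 0" by (simp add: h_def)
  have sub: "closed_segment x0 x \<subseteq> S"
    using assms by (simp add: convex_contains_segment)
  consider "x = x0" | "x0 < x" | "x < x0" by linarith
  then have "h x \<ge> 0"
  proof cases
    case 2
    then have sub: "{x0..x} \<subseteq> S" using sub by (simp add: closed_segment_eq_real_ivl)
    obtain s where s: "s \<in> {x0<..<x}" "h x - h x0 = k s * (x - x0)"
      using mvt_simple[OF 2, of h "\<lambda>s. (*) (k s)"] hder[OF _ sub] by auto
    have "k s \<ge> 0" using sgn[of s] s(1) sub by (auto simp: zero_le_mult_iff subset_iff)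
    then show ?thesis using s h0 2 by simp
  next
    case 3
    then have sub: "{x..x0} \<subseteq> S" using sub by (simp add: closed_segment_eq_real_ivl)
    obtain s where s: "s \<in> {x<..<x0}" "h x0 - h x = k s * (x0 - x)"
      using mvt_simple[OF 3, of h "\<lambda>s. (*) (k s)"] hder[OF _ sub] by auto
    have "k s \<le> 0" using sgn[of s] s(1) sub by (auto simp: zero_le_mult_iff subset_iff)
    then have "k s * (x0 - x) \<le> 0" using 3 by (simp add: mult_nonpos_nonneg)
    then show ?thesis using s h0 by simp
  qed (use h0 in simp)
  then show ?thesis by (simp add: h_def)
qed

lemma eventually_derivative_bound:
  fixes q1 :: "real \<Rightarrow> real"
  assumes "(q1 has_real_derivative q2) (at t0 within T)" "q1 t0 = 0"
  shows "\<exists>L>0. \<forall>\<^sub>F t in at t0 within T. \<bar>q1 t\<bar> \<le> L * \<bar>t - t0\<bar>"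
proof -
  have "((\<lambda>t. (q1 t - q1 t0) / (t - t0)) \<longlongrightarrow> q2) (at t0 within T)"
    using assms(1) by (simp add: has_field_derivative_iff)
  then have "\<forall>\<^sub>F t in at t0 within T. \<bar>(q1 t - q1 t0) / (t - t0)\<bar> < \<bar>q2\<bar> + 1"
    by (intro order_tendstoD(2)[OF tendsto_rabs]) auto
  moreover have "\<forall>\<^sub>F t in at t0 within T. t \<noteq> t0"
    by (simp add: eventually_at_filter)
  ultimately have "\<forall>\<^sub>F t in at t0 within T. \<bar>q1 t\<bar> \<le> (\<bar>q2\<bar> + 1) * \<bar>t - t0\<bar>"
    by eventually_elim (use assms(2) in \<open>simp add: abs_divide divide_simps\<close>)
  then show ?thesis by (intro exI[of _ "\<bar>q2\<bar> + 1"]) auto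
qed

text \<open>A Taylor estimate at a critical point that asks for the second derivative only at that point:
  there \<open>\<bar>q1 t\<bar> \<le> L * \<bar>t - t0\<bar>\<close> locally, and \<open>quadratic_lower_bound\<close> applied to \<open>-q\<close> integrates
  this bound.\<close>

lemma quadratic_upper_bound:
  fixes q q1 :: "real \<Rightarrow> real"
  assumes "convex T" "t0 \<in> T"
    and der: "\<And>t. t \<in> T \<Longrightarrow> (q has_real_derivative q1 t) (at t within T)"
    and der2: "(q1 has_real_derivative q2) (at t0 within T)" 
    and 0: "q1 t0 = 0"
  shows "\<exists>L>0. \<forall>\<^sub>F t in at t0 within T. q t \<le> q t0 + L * (t - t0)^2"
proof -
  obtain L where L: "L > 0" "\<forall>\<^sub>F t in at t0 within T. \<bar>q1 t\<bar> \<le> L * \<bar>t - t0\<bar>"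
    using eventually_derivative_bound[OF der2 0] by blast
  then obtain d where d: "d > 0" "\<And>t. t \<in> T \<Longrightarrow> t \<noteq> t0 \<Longrightarrow> dist t t0 < d \<Longrightarrow> \<bar>q1 t\<bar> \<le> L * \<bar>t - t0\<bar>"
    unfolding eventually_at by blast
  have bd: "\<bar>q1 t\<bar> \<le> L * \<bar>t - t0\<bar>" if "t \<in> T" "dist t t0 < d" for t
    using d(2)[OF that(1) _ that(2)] 0 by (cases "t = t0") auto
  have "q t \<le> q t0 + L / 2 * (t - t0)^2" if "t \<in> T" "dist t t0 < d" for t
  proof -
    let ?S = "T \<inter> ball t0 d"
    have "- q t \<ge> - q t0 + - q1 t0 * (t - t0) + (- (L/2)) * (t - t0)^2"
    proof (rule quadratic_lower_bound[where S = ?S and f = "\<lambda>t. - q t" and g = "\<lambda>t. - q1 t"])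
      show "convex ?S" using assms(1) by (simp add: convex_Int)
      show "t0 \<in> ?S" "t \<in> ?S" using that assms(2) d(1) by (auto simp: dist_commute)
      show "((\<lambda>t. - q t) has_real_derivative - q1 s) (at s within ?S)" if "s \<in> ?S" for s
        using that der[of s] by (auto intro!: DERIV_minus intro: DERIV_subset)
      show "(- q1 s - - q1 t0) * (s - t0) \<ge> 2 * - (L / 2) * (s - t0)\<^sup>2" if "s \<in> ?S" for s
      proof -
        have "\<bar>q1 s * (s - t0)\<bar> \<le> L * \<bar>s - t0\<bar> * \<bar>s - t0\<bar>"
          unfolding abs_mult using bd[of s] that
          by (intro mult_right_mono) (auto simp: dist_commute)
        also have "\<dots> = L * (s - t0)^2" by (simp add: power2_eq_square)
        finally show ?thesis using 0 by simp
      qed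
    qed
    then show ?thesis using 0 by simp
  qed
  then show ?thesis using L(1) d(1)
    by (intro exI[of _ "L/2"]) (auto simp: eventually_at)
qed

section \<open>Graphs of infinite curvature meet arcs of class \<open>C\<^sup>2\<close> finitely often\<close>

lemma graph_on_mem_iff: "p \<in> graph_on K f \<longleftrightarrow> p $ 1 \<in> K \<and> p $ 2 = f (p $ 1)"
proof
  assume "p $ 1 \<in> K \<and> p $ 2 = f (p $ 1)"
  moreover from this have "p = vector [p $ 1, f (p $ 1)]"
    by (simp add: vec_eq_iff forall_2)
  ultimately show "p \<in> graph_on K f" unfolding graph_on_def by blast
qed (auto simp: graph_on_def)

text \<open>If a \<open>C\<^sup>2\<close> arc with coordinates \<open>u, v\<close> meets the graph infinitely often, the parameters of the
  intersection points accumulate at some \<open>t0\<close>, which is again such a parameter. There the arc is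
  tangent to the graph, and its tangent is not vertical because its velocity is nonzero. So
  \<open>v - m * u\<close>, with \<open>m\<close> the slope of the tangent, deviates from its value at \<open>t0\<close> by at most
  \<open>L * (t - t0)\<^sup>2\<close>, while the points on the graph force a deviation of at least
  \<open>M * (u t - u t0)\<^sup>2\<close>, where \<open>\<bar>u t - u t0\<bar>\<close> is at least a fixed multiple of \<open>\<bar>t - t0\<bar>\<close>.
  For \<open>M\<close> large this is impossible.\<close>

lemma finite_inter_C2_arc:
  fixes f :: "real \<Rightarrow> real"
  assumes cl: "closed (graph_on K f)"
    and der: "\<And>x. x \<in> K \<Longrightarrow> (f has_real_derivative m x) (at x within K)"
    and curv: "\<And>x M. x \<in> K \<Longrightarrow>
        \<forall>\<^sub>F y in at x within K. f y \<ge> f x + m x * (y - x) + M * (y - x)^2"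
    and B: "Ck_arc 2 B"
  shows "finite (graph_on K f \<inter> B)"
proof (rule ccontr)
  let ?P = "graph_on K f"
  assume inf: "infinite (?P \<inter> B)"
  obtain a b \<gamma> where path: "path_onto a b \<gamma> B" and Ck: "Ck_on 2 \<gamma> {a..b}"
    and nz: "\<And>t. t \<in> {a..b} \<Longrightarrow> vector_derivative \<gamma> (at t within {a..b}) \<noteq> 0"
    using B unfolding Ck_arc_def by blast
  have ab: "a < b" and im: "\<gamma> ` {a..b} = B"
    using path by (auto simp: path_onto_def homeomorphism_def)
  obtain D where D0: "D 0 = \<gamma>"
    and D: "\<And>i t. i < 2 \<Longrightarrow> t \<in> {a..b} \<Longrightarrow>
          (D i has_vector_derivative D (Suc i) t) (at t within {a..b})"
    and cont: "\<And>i. i \<le> 2 \<Longrightarrow> continuous_on {a..b} (D i)"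
    using Ck unfolding Ck_on_def by blast
  have dercomp: "((\<lambda>t. D i t $ j) has_real_derivative D (Suc i) t $ j) (at t within {a..b})"
    if "i < 2" "t \<in> {a..b}" for i t j
    unfolding has_real_derivative_iff_has_vector_derivative
    by (rule bounded_linear.has_vector_derivative[OF bounded_linear_vec_nth D[OF that]])
  define S where "S = {a..b} \<inter> \<gamma> -` ?P"
  have "?P \<inter> B = \<gamma> ` S" unfolding S_def im[symmetric] by blast
  then have "infinite S" using inf by auto
  moreover have "S \<subseteq> {a..b}" unfolding S_def by blast
  ultimately obtain t0 where lim: "t0 islimpt S"
    using compact_eq_Bolzano_Weierstrass[of "{a..b}"] by auto
  have "closed S" unfolding S_def
    using cont[of 0] D0 cl by (intro continuous_closed_preimage) auto
  then have t0: "t0 \<in> S" using lim closed_limpt by blast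
  then have t0ab: "t0 \<in> {a..b}" using \<open>S \<subseteq> {a..b}\<close> by blast
  have nbot: "at t0 within S \<noteq> bot" using lim by (simp add: trivial_limit_within)
  define u v where "u t = \<gamma> t $ 1" and "v t = \<gamma> t $ 2" for t
  define u1 v1 where "u1 t = D 1 t $ 1" and "v1 t = D 1 t $ 2" for t
  have S_iff: "u t \<in> K" "v t = f (u t)" if "t \<in> S" for t
    using that by (auto simp: S_def u_def v_def graph_on_mem_iff)
  define x0 where "x0 = u t0"
  have x0: "x0 \<in> K" "v t0 = f x0" using S_iff[OF t0] by (auto simp: x0_def)
  have du: "(u has_real_derivative u1 t) (at t within {a..b})"
    and dv: "(v has_real_derivative v1 t) (at t within {a..b})" if "t \<in> {a..b}" for t
    using dercomp[of 0, OF _ that] unfolding u_def[abs_def] v_def[abs_def] u1_def v1_def D0 by auto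
  have duS: "(u has_real_derivative u1 t0) (at t0 within S)"
    and dvS: "(v has_real_derivative v1 t0) (at t0 within S)"
    using du[OF t0ab] dv[OF t0ab] \<open>S \<subseteq> {a..b}\<close> by (blast intro: DERIV_subset)+
  \<comment> \<open>Along \<open>S\<close> both \<open>v\<close> and \<open>f \<circ> u\<close> are differentiable and they agree, so the chain rule compares
    their derivatives at the accumulation point.\<close>
  have tangent: "v1 t0 = m x0 * u1 t0"
  proof -
    have "(f has_real_derivative m x0) (at (u t0) within u ` S)"
      using der[OF x0(1)] S_iff(1) by (auto simp: x0_def intro: DERIV_subset)
    from DERIV_image_chain[OF this duS]
    have "((\<lambda>t. f (u t)) has_real_derivative m x0 * u1 t0) (at t0 within S)"
      by (simp add: o_def)
    then have "(v has_real_derivative m x0 * u1 t0) (at t0 within S)"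
      by (rule has_field_derivative_transform_within[OF _ zero_less_one t0]) (use S_iff in auto)
    with dvS show ?thesis
      using tendsto_unique[OF nbot] unfolding has_field_derivative_iff by blast
  qed
  have u1: "u1 t0 \<noteq> 0"
  proof
    assume "u1 t0 = 0"
    then have "D 1 t0 = 0" using tangent by (simp add: u1_def v1_def vec_eq_iff forall_2)
    moreover have "vector_derivative \<gamma> (at t0 within {a..b}) = D 1 t0"
      using D[of 0 t0] t0ab ab unfolding D0
      by (intro vector_derivative_within_closed_interval) auto
    ultimately show False using nz[OF t0ab] by simp
  qed
  define q where "q t = v t - m x0 * u t" for t
  define q1 where "q1 t = v1 t - m x0 * u1 t" for t
  have "\<exists>L>0. \<forall>\<^sub>F t in at t0 within {a..b}. q t \<le> q t0 + L * (t - t0)^2"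
  proof (rule quadratic_upper_bound)
    show "(q has_real_derivative q1 t) (at t within {a..b})" if "t \<in> {a..b}" for t
      unfolding q_def q1_def using du[OF that] dv[OF that]
      by (auto intro!: derivative_eq_intros)
    show "(q1 has_real_derivative D 2 t0 $ 2 - m x0 * D 2 t0 $ 1) (at t0 within {a..b})"
      unfolding q1_def u1_def v1_def using dercomp[of 1, OF _ t0ab]
      by (auto intro!: derivative_eq_intros simp: numeral_2_eq_2)
    show "q1 t0 = 0" using tangent by (simp add: q1_def)
  qed (use t0ab in auto)
  then obtain L where L: "L > 0" "\<forall>\<^sub>F t in at t0 within {a..b}. q t \<le> q t0 + L * (t - t0)^2"
    by blast
  have ev1: "\<forall>\<^sub>F t in at t0 within S. q t \<le> q t0 + L * (t - t0)^2"
    using L(2) \<open>S \<subseteq> {a..b}\<close> at_le unfolding le_filter_def by blast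
  \<comment> \<open>Half of the horizontal speed bounds the difference quotients of \<open>u\<close> from below near \<open>t0\<close>;
    the factor \<open>M = L / c\<^sup>2\<close> is chosen below to beat the Taylor bound \<open>L\<close>.\<close>
  define c where "c = \<bar>u1 t0\<bar> / 2"
  have c: "c > 0" using u1 by (simp add: c_def)
  have neq: "\<forall>\<^sub>F t in at t0 within S. t \<noteq> t0" by (simp add: eventually_at_filter)
  have inS: "\<forall>\<^sub>F t in at t0 within S. t \<in> S" by (simp add: eventually_at_filter)
  have "((\<lambda>t. (u t - u t0) / (t - t0)) \<longlongrightarrow> u1 t0) (at t0 within S)"
    using duS by (simp add: has_field_derivative_iff)
  then have "\<forall>\<^sub>F t in at t0 within S. \<bar>(u t - u t0) / (t - t0)\<bar> > c"
    by (intro order_tendstoD(1)[OF tendsto_rabs]) (use u1 in \<open>auto simp: c_def\<close>)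
  with neq have ev2: "\<forall>\<^sub>F t in at t0 within S. \<bar>u t - x0\<bar> > c * \<bar>t - t0\<bar>"
    by eventually_elim (simp add: abs_divide divide_simps x0_def)
  have "\<forall>\<^sub>F t in at t0 within S. u t \<noteq> x0"
    using ev2 by eventually_elim (use c in \<open>auto simp: mult_less_0_iff\<close>)
  then have "filterlim u (at x0 within K) (at t0 within S)"
    unfolding filterlim_at using inS S_iff
    by (auto simp: eventually_conj_iff x0_def elim: eventually_mono
      intro: DERIV_continuous[OF duS, unfolded continuous_within])
  from eventually_compose_filterlim[OF curv[OF x0(1), of "L / c^2"] this]
  have ev3: "\<forall>\<^sub>F t in at t0 within S.
      f (u t) \<ge> f x0 + m x0 * (u t - x0) + L / c^2 * (u t - x0)^2" .
  have "\<forall>\<^sub>F t in at t0 within S. False"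
    using ev1 ev2 ev3 inS
  proof eventually_elim
    case (elim t)
    have "c^2 * (t - t0)^2 < (u t - x0)^2"
      using power_strict_mono[OF elim(2), of 2] c by (simp add: power_mult_distrib)
    then have "L * (t - t0)^2 < L / c^2 * (u t - x0)^2"
      using c L(1) by (simp add: field_simps)
    also have "\<dots> \<le> q t - q t0"
      using elim(3) S_iff[OF elim(4)] x0 by (simp add: q_def x0_def algebra_simps)
    finally show False using elim(1) by simp
  qed
  then show False using nbot by simp
qed

section \<open>Points on the graph of a convex function\<close>

lemma vector_2_axis: "vector [x, y] = x *\<^sub>R axis 1 1 + y *\<^sub>R (axis 2 1 :: real^2)"
  by (simp add: vec_eq_iff forall_2 axis_def)

text \<open>All points of the graph lie on one side of the supporting line through a given one of them, so
  that point lies on the boundary of a half-plane that contains every triangle with vertices on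
  the graph.\<close>

lemma non_squiggly_of_supporting_lines:
  assumes "\<And>x y. x \<in> K \<Longrightarrow> y \<in> K \<Longrightarrow> f y \<ge> f x + m x * (y - x)"
  shows "non_squiggly (graph_on K f)"
proof -
  have "t \<notin> interior (convex hull {x, y, z})"
    if "x \<in> graph_on K f" "y \<in> graph_on K f" "z \<in> graph_on K f" "t \<in> graph_on K f"
    for x y z t
  proof
    assume t: "t \<in> interior (convex hull {x, y, z})"
    \<comment> \<open>a downward normal vector of the supporting line at \<open>t\<close>\<close>
    define n :: "real^2" where "n = vector [m (t $ 1), -1]"
    have n: "n \<bullet> p = m (t $ 1) * p $ 1 - p $ 2" for p
      by (simp add: n_def inner_vec_def sum_2)
    have "n \<noteq> 0" by (simp add: n_def vec_eq_iff forall_2)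
    have "p \<in> {p. n \<bullet> p \<le> n \<bullet> t}" if "p \<in> graph_on K f" for p
      using assms[of "t $ 1" "p $ 1"] that \<open>t \<in> graph_on K f\<close>
      by (simp add: n graph_on_mem_iff algebra_simps)
    then have "convex hull {x, y, z} \<subseteq> {p. n \<bullet> p \<le> n \<bullet> t}"
      using that by (intro hull_minimal convex_halfspace_le) auto
    then have "t \<in> interior {p. n \<bullet> p \<le> n \<bullet> t}"
      using t interior_mono by blast
    then show False using \<open>n \<noteq> 0\<close> by simp
  qed
  then show ?thesis unfolding non_squiggly_def
    by (intro exI[of _ "\<infinity>"]) auto
qed

lemma Ck_arc_graph:
  assumes ab: "a < b"
    and der: "\<And>x. x \<in> {a..b} \<Longrightarrow> (f has_real_derivative g x) (at x within {a..b})"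
    and cont: "continuous_on {a..b} g"
  shows "Ck_arc 1 (graph_on {a..b} f)"
proof -
  define \<gamma> :: "real \<Rightarrow> real^2" where "\<gamma> x = vector [x, f x]" for x
  define \<gamma>1 :: "real \<Rightarrow> real^2" where "\<gamma>1 x = vector [1, g x]" for x
  have d: "(\<gamma> has_vector_derivative \<gamma>1 x) (at x within {a..b})" if "x \<in> {a..b}" for x
    unfolding \<gamma>_def \<gamma>1_def vector_2_axis using der[OF that]
    by (auto intro!: derivative_eq_intros simp: has_real_derivative_iff_has_vector_derivative)
  have c1: "continuous_on {a..b} \<gamma>1"
    unfolding \<gamma>1_def vector_2_axis using cont by (intro continuous_intros)
  have c0: "continuous_on {a..b} \<gamma>"
    by (rule continuous_on_vector_derivative[OF d])
  have hom: "homeomorphism {a..b} (graph_on {a..b} f) \<gamma> (\<lambda>p. p $ 1)"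
    unfolding homeomorphism_def
    using c0 by (auto simp: graph_on_def \<gamma>_def image_image intro!: continuous_intros)
  have "Ck_on 1 \<gamma> {a..b}"
    unfolding Ck_on_def using d c0 c1
    by (intro exI[of _ "\<lambda>i. if i = 0 then \<gamma> else \<gamma>1"]) auto
  moreover have "path_onto a b \<gamma> (graph_on {a..b} f)"
    using hom ab homeomorphic_sym unfolding path_onto_def arc_set_def homeomorphic_def by blast
  moreover have "vector_derivative \<gamma> (at x within {a..b}) \<noteq> 0" if "x \<in> {a..b}" for x
  proof -
    have "vector_derivative \<gamma> (at x within {a..b}) = \<gamma>1 x"
      using ab d that by (intro vector_derivative_within_closed_interval) auto
    moreover have "\<gamma>1 x $ 1 = 1" by (simp add: \<gamma>1_def)
    ultimately show ?thesis by (metis zero_index zero_neq_one)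
  qed
  ultimately show ?thesis unfolding Ck_arc_def by blast
qed

section \<open>A nowhere dense perfect set of reals\<close>

definition tent :: "real \<Rightarrow> real" where
  "tent x = 3 * min x (1 - x)"

text \<open>This is the middle-thirds Cantor set: it consists of the points whose orbit under the tent map
  of slope 3 never leaves the unit interval. In this form closedness is the continuity of the
  iterates, and self-similarity is invariance under the tent map.\<close>

definition cantor :: "real set" where
  "cantor = {x. \<forall>n. (tent ^^ n) x \<in> {0..1}}"

lemma cantor_iff: "x \<in> cantor \<longleftrightarrow> x \<in> {0..1} \<and> tent x \<in> cantor"
proof
  assume x: "x \<in> cantor"
  have "(tent ^^ n) (tent x) \<in> {0..1}" for n
    using x unfolding cantor_def by (auto simp: funpow_swap1 dest: spec[of _ "Suc n"])
  moreover have "x \<in> {0..1}" using x unfolding cantor_def by (auto dest: spec[of _ 0])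
  ultimately show "x \<in> {0..1} \<and> tent x \<in> cantor" unfolding cantor_def by blast
next
  assume "x \<in> {0..1} \<and> tent x \<in> cantor"
  then have "(tent ^^ n) x \<in> {0..1}" for n
    by (cases n) (auto simp: cantor_def funpow_Suc_right simp del: funpow.simps(2))
  then show "x \<in> cantor" unfolding cantor_def by blast
qed

lemma closed_cantor: "closed cantor"
proof -
  have "continuous_on UNIV (tent ^^ n)" for n
  proof (induction n)
    case (Suc n)
    have "continuous_on UNIV tent" unfolding tent_def by (intro continuous_intros)
    then have "continuous_on UNIV (tent \<circ> (tent ^^ n))"
      using Suc by (intro continuous_on_compose) (auto intro: continuous_on_subset)
    then show ?case by (simp add: o_def)
  qed simp
  then have "closed ((tent ^^ n) -` {0..1})" for n
    by (intro closed_vimage) auto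
  then have "closed (\<Inter>n. (tent ^^ n) -` {0..1})" by (intro closed_INT) blast
  moreover have "cantor = (\<Inter>n. (tent ^^ n) -` {0..1})" unfolding cantor_def by blast
  ultimately show ?thesis by simp
qed

lemma cantor_subset: "cantor \<subseteq> {0..1}"
  using cantor_iff by blast

lemma compact_cantor: "compact cantor"
  using closed_cantor cantor_subset compact_Icc[of "0::real" 1] closed_Int_compact
  by (metis inf.absorb1)

lemma cantor_scale:
  assumes "y \<in> cantor" shows "y / 3 \<in> cantor" "1 - y / 3 \<in> cantor"
proof -
  have "y \<in> {0..1}" using assms cantor_subset by blast
  then have "tent (y / 3) = y" "tent (1 - y / 3) = y" by (auto simp: tent_def)
  with assms \<open>y \<in> {0..1}\<close> show "y / 3 \<in> cantor" "1 - y / 3 \<in> cantor"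
    by (subst cantor_iff; auto)+
qed

lemma zero_in_cantor: "0 \<in> cantor"
proof -
  have "(tent ^^ n) 0 = 0" for n by (induction n) (auto simp: tent_def)
  then show ?thesis unfolding cantor_def by simp
qed

lemma one_in_cantor: "1 \<in> cantor"
  using cantor_scale(2)[OF zero_in_cantor] by simp

text \<open>The points 0 and 1 give neighbours at scale 1, and the two inverse branches of the tent map
  carry neighbours to neighbours at a third of the distance.\<close>

lemma cantor_near:
  assumes "x \<in> cantor"
  shows "\<exists>y\<in>cantor. y \<noteq> x \<and> \<bar>y - x\<bar> \<le> (1/3) ^ n"
  using assms
proof (induction n arbitrary: x)
  case 0
  show ?case
  proof (cases "x = 0")
    case True
    then show ?thesis using one_in_cantor by (intro bexI[of _ 1]) auto
  next
    case False
    then show ?thesis using zero_in_cantor 0 cantor_subset by (intro bexI[of _ 0]) auto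
  qed
next
  case (Suc n)
  then obtain y where y: "y \<in> cantor" "y \<noteq> tent x" "\<bar>y - tent x\<bar> \<le> (1/3)^n"
    using cantor_iff by blast
  show ?case
  proof (cases "x \<le> 1/2")
    case True
    then have x: "tent x = 3 * x" by (simp add: tent_def)
    show ?thesis using cantor_scale(1)[OF y(1)] y(2,3) x
      by (intro bexI[of _ "y/3"]) (auto simp: abs_if split: if_splits)
  next
    case False
    then have x: "tent x = 3 * (1 - x)" by (simp add: tent_def)
    show ?thesis using cantor_scale(2)[OF y(1)] y(2,3) x
      by (intro bexI[of _ "1 - y/3"]) (auto simp: abs_if split: if_splits)
  qed
qed

lemma cantor_islimpt:
  assumes "x \<in> cantor" shows "x islimpt cantor"
  unfolding islimpt_approachable
proof (intro allI impI)
  fix e :: real assume "e > 0"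
  then obtain n where "(1/3) ^ n < e" using real_arch_pow_inv[of e "1/3"] by auto
  then show "\<exists>x'\<in>cantor. x' \<noteq> x \<and> dist x' x < e"
    using cantor_near[OF assms, of n] by (force simp: dist_real_def)
qed

text \<open>An interval contained in the set avoids the midpoint 1/2, so the tent map is affine on it and
  maps it to an interval of three times the length, again contained in the set.\<close>

lemma cantor_interval_short:
  assumes "x \<le> y" "{x..y} \<subseteq> cantor"
  shows "y - x \<le> (1/3) ^ n"
  using assms
proof (induction n arbitrary: x y)
  case 0
  then have "x \<in> cantor" "y \<in> cantor" by auto
  then have "x \<in> {0..1}" "y \<in> {0..1}" using cantor_subset by blast+
  then show ?case by simp
next
  case (Suc n)
  have "(1/2) \<notin> cantor"
    using cantor_subset by (subst cantor_iff) (auto simp: tent_def)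
  then have "1/2 \<notin> {x..y}" using Suc.prems by blast
  then consider "y < 1/2" | "x > 1/2" by force
  then show ?case
  proof cases
    case 1
    have "z \<in> cantor" if "z \<in> {3 * x..3 * y}" for z
    proof -
      have "z / 3 \<in> cantor" using that Suc.prems by auto
      moreover have "tent (z / 3) = z" using that 1 by (auto simp: tent_def)
      ultimately show ?thesis using cantor_iff by metis
    qed
    then have "{3 * x..3 * y} \<subseteq> cantor" by blast
    then show ?thesis using Suc.IH[of "3 * x" "3 * y"] Suc.prems(1) by simp
  next
    case 2
    have "z \<in> cantor" if "z \<in> {3 * (1 - y)..3 * (1 - x)}" for z
    proof -
      have "1 - z / 3 \<in> cantor" using that Suc.prems by auto
      moreover have "tent (1 - z / 3) = z" using that 2 by (auto simp: tent_def)
      ultimately show ?thesis using cantor_iff by metis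
    qed
    then have "{3 * (1 - y)..3 * (1 - x)} \<subseteq> cantor" by blast
    then show ?thesis using Suc.IH[of "3 * (1 - y)" "3 * (1 - x)"] Suc.prems(1) by simp
  qed
qed

lemma cantor_nowhere_dense:
  assumes "x < y" shows "\<exists>z\<in>{x<..<y}. z \<notin> cantor"
proof (rule ccontr)
  assume cover: "\<not> ?thesis"
  \<comment> \<open>the middle third, a closed interval inside the open one\<close>
  define x' y' where "x' = (2 * x + y) / 3" and "y' = (x + 2 * y) / 3"
  have xy: "x < x'" "x' < y'" "y' < y" using assms by (auto simp: x'_def y'_def)
  then have sub: "{x'..y'} \<subseteq> cantor" using cover by auto
  obtain n where "(1/3) ^ n < y' - x'" using real_arch_pow_inv[of "y' - x'" "1/3"] xy by auto
  then show False using cantor_interval_short[of x' y' n] sub xy by auto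
qed

section \<open>The convex function with infinite second derivative on a perfect set\<close>

text \<open>An antiderivative of the distance to the Cantor set. It is strictly increasing since otherwise
  it would be constant on an interval, which would force the distance to vanish there although
  the Cantor set contains no interval.\<close>

lemma cantor_flat_function:
  obtains \<phi> :: "real \<Rightarrow> real" where
    "strict_mono_on {0..1} \<phi>" "continuous_on {0..1} \<phi>"
    "\<And>c. c \<in> cantor \<Longrightarrow> (\<phi> has_real_derivative 0) (at c within {0..1})"
proof -
  obtain \<phi> where d: "\<And>y. y \<in> {0..1} \<Longrightarrow>
      (\<phi> has_real_derivative infdist y cantor) (at y within {0..1})"
    using antiderivative_continuous[of 0 1 "\<lambda>y. infdist y cantor"]
    by (auto simp: has_real_derivative_iff_has_vector_derivative continuous_intros)
  have mono: "\<phi> x \<le> \<phi> y" if "x \<in> {0..1}" "y \<in> {0..1}" "x \<le> y" for x y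
  proof (cases "x = y")
    case False
    then have "x < y" using that by simp
    moreover have "(\<phi> has_derivative (*) (infdist s cantor)) (at s within {x..y})"
      if "x \<le> s" "s \<le> y" for s
      using d[of s] that \<open>x \<in> {0..1}\<close> \<open>y \<in> {0..1}\<close> DERIV_subset[of \<phi> _ s "{0..1}" "{x..y}"]
      by (auto simp: has_field_derivative_def)
    ultimately obtain s where "\<phi> y - \<phi> x = infdist s cantor * (y - x)"
      using mvt_simple[of x y \<phi> "\<lambda>s. (*) (infdist s cantor)"] by blast
    then show ?thesis using \<open>x < y\<close> infdist_nonneg[of s cantor]
      by (metis diff_ge_0_iff_ge less_imp_le mult_nonneg_nonneg)
  qed (use that in simp)
  have "\<phi> x < \<phi> y" if xy: "x \<in> {0..1}" "y \<in> {0..1}" "x < y" for x y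
  proof (rule ccontr)
    assume "\<not> \<phi> x < \<phi> y"
    obtain z where z: "z \<in> {x<..<y}" "z \<notin> cantor" using cantor_nowhere_dense xy by blast
    have const: "\<phi> s = \<phi> x" if "s \<in> {x<..<y}" for s
      using mono[of x s] mono[of s y] that xy \<open>\<not> \<phi> x < \<phi> y\<close> by auto
    have "(\<phi> has_real_derivative infdist z cantor) (at z within {x<..<y})"
      by (rule DERIV_subset[OF d[of z]]) (use z xy in auto)
    then have "(\<phi> has_real_derivative infdist z cantor) (at z)"
      by (simp only: at_within_open[OF z(1) open_greaterThanLessThan])
    moreover have "(\<phi> has_real_derivative 0) (at z)"
      by (rule has_field_derivative_transform_within_open[of "\<lambda>_. \<phi> x" _ _ "{x<..<y}"])
        (use z const in auto)
    ultimately have "infdist z cantor = 0" by (rule DERIV_unique)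
    then show False using z closed_cantor zero_in_cantor in_closed_iff_infdist_zero by blast
  qed
  then have "strict_mono_on {0..1} \<phi>" by (auto intro!: strict_mono_onI)
  moreover have "continuous_on {0..1} \<phi>"
    using d by (rule DERIV_continuous_on)
  moreover have "(\<phi> has_real_derivative 0) (at c within {0..1})" if "c \<in> cantor" for c
    using d[of c] that cantor_subset by auto
  ultimately show thesis using that by blast
qed

lemma perfect_set_image:
  fixes F :: "'a::metric_space \<Rightarrow> 'b::metric_space"
  assumes "compact C" "C \<noteq> {}" "\<And>c. c \<in> C \<Longrightarrow> c islimpt C" "continuous_on C F" "inj_on F C"
  shows "perfect_set (F ` C)"
proof -
  have "\<not> F c isolated_in F ` C" if c: "c \<in> C" for c
  proof
    assume "F c isolated_in F ` C"
    then obtain T where T: "open T" "T \<inter> F ` C = {F c}" unfolding isolated_in_def by blast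
    obtain U where U: "open U" "U \<inter> C = F -` T \<inter> C"
      using assms(4) T(1) unfolding continuous_on_open_invariant by blast
    then have "c \<in> U" using T c by blast
    then obtain c' where "c' \<in> C" "c' \<in> U" "c' \<noteq> c"
      using assms(3)[OF c] U(1) unfolding islimpt_def by blast
    then have "F c' \<in> T \<inter> F ` C" using U(2) by blast
    then have "F c' = F c" using T(2) by blast
    then show False using \<open>c' \<in> C\<close> \<open>c' \<noteq> c\<close> c assms(5) by (auto dest: inj_onD)
  qed
  moreover have "closed (F ` C)"
    using compact_continuous_image[OF assms(4,1)] compact_imp_closed by blast
  ultimately show ?thesis using assms(2) unfolding perfect_set_def by blast
qed

text \<open>Since \<open>\<phi>\<close> has slope 0 at \<open>g x\<close>, its inverse \<open>g\<close> has slope \<open>+\<infinity>\<close> at \<open>x\<close>; integrating this gives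
  the quadratic bound for \<open>f\<close> with every factor \<open>M\<close>.\<close>

lemma steep_derivative_imp_parabola_bound:
  fixes f g \<phi> :: "real \<Rightarrow> real"
  assumes g_inv: "\<And>s. s \<in> {a..b} \<Longrightarrow> g s \<in> {0..1} \<and> \<phi> (g s) = s"
    and g_mono: "mono_on {a..b} g" and g_cont: "continuous_on {a..b} g"
    and f: "\<And>s. s \<in> {a..b} \<Longrightarrow> (f has_real_derivative g s) (at s within {a..b})"
    and x: "x \<in> {a..b}"
    and flat: "(\<phi> has_real_derivative 0) (at (g x) within {0..1})"
  shows "\<forall>\<^sub>F y in at x within {a..b}. f y \<ge> f x + g x * (y - x) + M * (y - x)^2"
proof -
  \<comment> \<open>a positive slope that dominates \<open>2 * M\<close>, whatever the sign of \<open>M\<close>\<close>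
  define N where "N = 2 * \<bar>M\<bar> + 1"
  have N: "N > 0" "N \<ge> 2 * M" by (auto simp: N_def)
  have "((\<lambda>t. (\<phi> t - \<phi> (g x)) / (t - g x)) \<longlongrightarrow> 0) (at (g x) within {0..1})"
    using flat by (simp add: has_field_derivative_iff)
  then have "\<forall>\<^sub>F t in at (g x) within {0..1}. \<bar>(\<phi> t - \<phi> (g x)) / (t - g x)\<bar> < 1 / N"
    using N by (intro order_tendstoD(2)[OF tendsto_rabs]) auto
  then obtain e where e: "e > 0" "\<And>t. t \<in> {0..1} \<Longrightarrow> t \<noteq> g x \<Longrightarrow> dist t (g x) < e \<Longrightarrow>
      \<bar>(\<phi> t - \<phi> (g x)) / (t - g x)\<bar> < 1 / N"
    unfolding eventually_at by blast
  obtain d where d: "d > 0" "\<And>s. s \<in> {a..b} \<Longrightarrow> dist s x < d \<Longrightarrow> dist (g s) (g x) < e"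
    using g_cont x e(1) unfolding continuous_on_iff by blast
  have steep: "(g s - g x) * (s - x) \<ge> 2 * M * (s - x)^2" if s: "s \<in> {a..b}" "dist s x < d" for s
  proof (cases "g s = g x")
    case True
    then have "s = x" using g_inv[OF s(1)] g_inv[OF x] by metis
    then show ?thesis by simp
  next
    case False
    have "\<bar>(\<phi> (g s) - \<phi> (g x)) / (g s - g x)\<bar> < 1 / N"
      using e(2) d(2) s g_inv False by blast
    then have "\<bar>s - x\<bar> * N \<le> \<bar>g s - g x\<bar>"
      using g_inv[OF s(1)] g_inv[OF x] N(1) False by (simp add: abs_divide field_simps)
    then have "(\<bar>s - x\<bar> * N) * \<bar>s - x\<bar> \<le> \<bar>g s - g x\<bar> * \<bar>s - x\<bar>"
      by (intro mult_right_mono) auto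
    also have "\<dots> = (g s - g x) * (s - x)"
    proof (cases "x \<le> s")
      case True
      then show ?thesis using mono_onD[OF g_mono x s(1)] by simp
    next
      case False
      then show ?thesis using mono_onD[OF g_mono s(1) x] by (simp add: abs_if algebra_simps)
    qed
    finally have "N * (s - x)^2 \<le> (g s - g x) * (s - x)"
      by (simp add: power2_eq_square mult.commute mult.left_commute)
    moreover have "2 * M * (s - x)^2 \<le> N * (s - x)^2" using N by (intro mult_right_mono) auto
    ultimately show ?thesis by linarith
  qed
  have "f y \<ge> f x + g x * (y - x) + M * (y - x)^2" if y: "y \<in> {a..b}" "dist y x < d" for y
  proof (rule quadratic_lower_bound[where S = "{a..b} \<inter> ball x d"])
    show "(f has_real_derivative g s) (at s within {a..b} \<inter> ball x d)"
      if "s \<in> {a..b} \<inter> ball x d" for s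
      using that f[of s] by (auto intro: DERIV_subset)
  qed (use x y d(1) steep in \<open>auto simp: dist_commute convex_Int\<close>)
  then show ?thesis using d(1) by (auto simp: eventually_at)
qed

theorem theorem1p5:
  shows "\<exists>P A :: (real ^ 2) set.
    perfect_set P \<and> non_squiggly P \<and> Ck_arc 1 A \<and> P \<subseteq> A \<and>
    (\<forall>B :: (real ^ 2) set. Ck_arc 2 B \<longrightarrow> finite (P \<inter> B)) \<and>
    (\<exists>a b f. a < b \<and> convex_differentiable_on a b f \<and> A = graph_on {a..b} f)"
proof -
  obtain \<phi> :: "real \<Rightarrow> real" where \<phi>: "strict_mono_on {0..1} \<phi>" "continuous_on {0..1} \<phi>"
    and flat: "\<And>c. c \<in> cantor \<Longrightarrow> (\<phi> has_real_derivative 0) (at c within {0..1})"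
    using cantor_flat_function by blast
  define a b where "a = \<phi> 0" and "b = \<phi> 1"
  have ab: "a < b" using strict_mono_onD[OF \<phi>(1), of 0 1] by (simp add: a_def b_def)
  have mono: "mono_on {0..1} \<phi>" using \<phi>(1) strict_mono_on_imp_mono_on by blast
  have inj: "inj_on \<phi> {0..1}" using \<phi>(1) strict_mono_on_imp_inj_on by blast
  have im: "\<phi> ` {0..1} = {a..b}"
  proof
    show "\<phi> ` {0..1} \<subseteq> {a..b}"
      using mono_onD[OF mono, of 0] mono_onD[OF mono, of _ 1] unfolding a_def b_def by auto
    show "{a..b} \<subseteq> \<phi> ` {0..1}"
    proof
      fix s assume "s \<in> {a..b}"
      then obtain t where "0 \<le> t" "t \<le> 1" "\<phi> t = s"
        using IVT'[of \<phi> 0 s 1] \<phi>(2) unfolding a_def b_def by auto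
      then show "s \<in> \<phi> ` {0..1}" by auto
    qed
  qed
  define g where "g = inv_into {0..1} \<phi>"
  have g_inv: "g s \<in> {0..1} \<and> \<phi> (g s) = s" if "s \<in> {a..b}" for s
    using that f_inv_into_f[of s \<phi> "{0..1}"] inv_into_into[of s \<phi> "{0..1}"]
    unfolding im g_def by blast
  have g_\<phi>: "g (\<phi> c) = c" if "c \<in> {0..1}" for c
    unfolding g_def using inv_into_f_f[OF inj that] .
  have g_cont: "continuous_on {a..b} g"
    using continuous_on_inv[OF \<phi>(2), of g] g_\<phi> im by auto
  have g_mono: "mono_on {a..b} g"
  proof (rule mono_onI)
    fix r s assume rs: "r \<in> {a..b}" "s \<in> {a..b}" "r \<le> s"
    show "g r \<le> g s"
    proof (rule ccontr)
      assume "\<not> g r \<le> g s"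
      then have "\<phi> (g s) < \<phi> (g r)"
        using g_inv[OF rs(1)] g_inv[OF rs(2)] by (intro strict_mono_onD[OF \<phi>(1)]) auto
      then show False using g_inv[OF rs(1)] g_inv[OF rs(2)] rs(3) by simp
    qed
  qed
  obtain f where f: "\<And>s. s \<in> {a..b} \<Longrightarrow> (f has_real_derivative g s) (at s within {a..b})"
    using antiderivative_continuous[OF g_cont]
    unfolding has_real_derivative_iff_has_vector_derivative by blast
  define K where "K = \<phi> ` cantor"
  have K: "K \<subseteq> {a..b}" using im cantor_subset unfolding K_def by blast
  have perfect: "perfect_set (graph_on K f)"
  proof -
    have "continuous_on {a..b} f"
      using f by (rule DERIV_continuous_on)
    then have "continuous_on {0..1} (\<lambda>c. f (\<phi> c))"
      using \<phi>(2) im by (auto intro: continuous_on_compose2)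
    then have "continuous_on {0..1} (\<lambda>c. vector [\<phi> c, f (\<phi> c)] :: real^2)"
      unfolding vector_2_axis using \<phi>(2) by (intro continuous_intros)
    then have "continuous_on cantor (\<lambda>c. vector [\<phi> c, f (\<phi> c)] :: real^2)"
      using cantor_subset continuous_on_subset by blast
    moreover have "inj_on (\<lambda>c. vector [\<phi> c, f (\<phi> c)] :: real^2) cantor"
    proof (rule inj_onI)
      fix c c' assume c: "c \<in> cantor" "c' \<in> cantor"
        "(vector [\<phi> c, f (\<phi> c)] :: real^2) = vector [\<phi> c', f (\<phi> c')]"
      then have "\<phi> c = \<phi> c'" by (metis vector_2(1))
      then show "c = c'" using inj c(1,2) cantor_subset by (auto dest: inj_onD)
    qed
    ultimately have "perfect_set ((\<lambda>c. vector [\<phi> c, f (\<phi> c)] :: real^2) ` cantor)"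
      using compact_cantor zero_in_cantor cantor_islimpt by (intro perfect_set_image) auto
    then show ?thesis by (simp add: graph_on_def K_def image_image)
  qed
  have "non_squiggly (graph_on K f)"
  proof (rule non_squiggly_of_supporting_lines)
    fix x y assume xy: "x \<in> K" "y \<in> K"
    have "(g s - g x) * (s - x) \<ge> 0" if "s \<in> {a..b}" for s
      using mono_onD[OF g_mono, of s x] mono_onD[OF g_mono, of x s] that xy K
      by (cases "x \<le> s") (auto simp: mult_nonpos_nonpos)
    moreover have "x \<in> {a..b}" "y \<in> {a..b}" using xy K by blast+
    ultimately show "f y \<ge> f x + g x * (y - x)"
      using quadratic_lower_bound[of "{a..b}" x y f g 0] f by auto
  qed
  moreover have "finite (graph_on K f \<inter> B)" if "Ck_arc 2 B" for B
  proof (rule finite_inter_C2_arc[OF _ _ _ that])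
    show "closed (graph_on K f)" using perfect by (simp add: perfect_set_def)
    show "(f has_real_derivative g x) (at x within K)" if "x \<in> K" for x
      by (rule DERIV_subset[OF f K]) (use that K in blast)
    show "\<forall>\<^sub>F y in at x within K. f x + g x * (y - x) + M * (y - x)\<^sup>2 \<le> f y" if "x \<in> K" for x M
    proof -
      obtain c where c: "c \<in> cantor" "x = \<phi> c" using \<open>x \<in> K\<close> unfolding K_def by blast
      then have "g x = c" using g_\<phi> cantor_subset by blast
      then have "\<forall>\<^sub>F y in at x within {a..b}. f x + g x * (y - x) + M * (y - x)\<^sup>2 \<le> f y"
        using steep_derivative_imp_parabola_bound[OF g_inv g_mono g_cont f] flat[OF c(1)] that K by blast
      then show ?thesis using at_le[OF K, of x] unfolding le_filter_def by blast
    qed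
  qed
  moreover have "Ck_arc 1 (graph_on {a..b} f)" using Ck_arc_graph ab f g_cont by blast
  moreover have "graph_on K f \<subseteq> graph_on {a..b} f" using K unfolding graph_on_def by blast
  moreover have "convex_differentiable_on a b f"
    using f g_mono unfolding convex_differentiable_on_def by blast
  ultimately show ?thesis using perfect ab by blast
qed

end
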